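(* Let $n\ge 1$ and let $\lambda\in\Lambda^+(n)$. Then $\lambda_1\le n(l-1)$ if and only if we can write $n$ as a sum of positive integers $n_1,\dots,n_s$ and $\lambda=\lambda(1)+\cdots+\lambda(s)$ with $\lambda(i)\in\Lambda^+(n)$ an $n_i$-distinguished partition, for $1\le i\le s$.
   Context: $l$ is the smallest positive integer with $1+q+\cdots+q^{l-1}=0$, where $q$ is a non-zero root of unity in a field $K$, with $q\ne1$ if $K$ has characteristic $0$ (so $l\ge 2$ is an integer). $\Lambda^+(n)$ denotes the set of partitions with at most $n$ parts, regarded as $n$-tuples $\lambda_1\ge\cdots\ge\lambda_n\ge0$ of integers, added entrywise. For $0<m<l$, a partition $\lambda$ is $m$-distinguished if $\lambda=\lambda^0+l\bar\lambda$ where $\lambda^0=(l-m,\dots,l-m,a_1,\dots,a_m)$ with the entry $l-m$ occurring $k\ge0$ times at the start and $l-m>a_1\ge\cdots\ge a_m\ge0$, and $\bar\lambda$ is a partition with $\bar\lambda_1<m$. Partitions are identified up to trailing zeros. *)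

theory Defs
  imports Complex_Main "HOL-Library.More_List" "HOL-Computational_Algebra.Computational_Algebra"
begin

text \<open>
  A partition is the infinite weakly decreasing sequence obtained by appending zeros, so partitions
  that differ only by trailing zeros are equal. Indices start at 0: the first part of
  \<open>lam\<close> is \<open>lam 0\<close>.
\<close>

definition is_partition :: "(nat \<Rightarrow> nat) \<Rightarrow> bool" where
  "is_partition lam \<longleftrightarrow> antimono lam \<and> (\<exists>N. \<forall>i\<ge>N. lam i = 0)"

definition Lambda_plus :: "nat \<Rightarrow> (nat \<Rightarrow> nat) set" where
  "Lambda_plus n = {lam. is_partition lam \<and> (\<forall>i\<ge>n. lam i = 0)}"

text \<open>
  The existence of a positive \<open>l\<close> as below is guaranteed when \<open>q\<close> is a root of unity
  that differs from 1 if the characteristic is 0.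
\<close>

definition quantum_char :: "'a::field \<Rightarrow> nat" where
  "quantum_char q = (LEAST l. 0 < l \<and> (\<Sum>i<l. q ^ i) = 0)"

definition distinguished :: "nat \<Rightarrow> nat \<Rightarrow> (nat \<Rightarrow> nat) \<Rightarrow> bool" where
  "distinguished l m lam \<longleftrightarrow> 0 < m \<and> m < l \<and>
     (\<exists>k a lbar.
        length a = m \<and> sorted_wrt (\<ge>) a \<and> (\<forall>x\<in>set a. x < l - m) \<and>
        is_partition lbar \<and> lbar 0 < m \<and>
        lam = (\<lambda>j. nth_default 0 (replicate k (l - m) @ a) j + l * lbar j))"

end

theory Submission
  imports Defs
begin

text \<open>
  Each \<open>m\<close>-distinguished partition has first part at most
  \<open>(l - m) + l * (m - 1) = m * (l - 1)\<close>, and these bounds add up; this is the easy direction.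

  For the converse, replace a partition by the multiset of its column heights, so that adding
  partitions becomes taking unions of multisets. Allow columns of height 0. An
  \<open>m\<close>-distinguished partition then consists of \<open>l - m\<close> heights lying in an interval of length
  \<open>m\<close> (a \<^emph>\<open>narrow\<close> group, formed by the columns of \<open>\<lambda>\<^sup>0\<close>), together with \<open>m - 1\<close> arbitrary heights,
  each repeated \<open>l\<close> times. In total these are \<open>m * (l - 1)\<close> heights. The partition \<open>lam\<close>, with zero
  heights added, is a multiset \<open>M\<close> of exactly \<open>n * (l - 1)\<close> heights in \<open>{0..n}\<close>, and \<open>M\<close> has to be
  cut into pieces of this shape with the numbers \<open>m\<close> adding up to \<open>n\<close>.

  Write \<open>M = R + l * B\<close>, where every height occurs less than \<open>l\<close> times in \<open>R\<close>. Run through \<open>R\<close>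
  in increasing order and cut it greedily into narrow groups, always taking the longest group possible
  (\<open>greedy_narrow_groups\<close>). When a group of size \<open>l - m\<close> cannot be extended, the next height exceeds
  its first one by at least \<open>m\<close>. As the heights are at most \<open>n\<close>, so is the sum \<open>P\<close> of the numbers
  \<open>m\<close>; for the last group, which has no next height, this follows by counting modulo \<open>l\<close>. The same
  count gives \<open>n - P = l * u\<close> for some \<open>u\<close>.
  This deficit is made up by \<open>u\<close> heights of \<open>B\<close>: the \<open>l\<close> copies of a height \<open>b\<close> split into a
  narrow group of size \<open>1\<close> and one of size \<open>l - 1\<close>, which contribute \<open>(l - 1) + 1 = l\<close>
  (\<open>blocks_as_narrow_groups\<close>). Since the total size is right, the remaining heights of \<open>B\<close> are
  just enough to give \<open>m - 1\<close> of them to each group of size \<open>l - m\<close> (\<open>distribute_blocks\<close>).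
\<close>

section \<open>Partitions as multisets of column heights\<close>

text \<open>
  The partition whose Young diagram has the elements of \<open>M\<close> as column heights. Heights 0 are
  allowed and do not change the partition; they let the number of columns be prescribed.
\<close>

definition of_columns :: "nat multiset \<Rightarrow> nat \<Rightarrow> nat" where
  "of_columns M j = size (filter_mset (\<lambda>x. j < x) M)"

lemma of_columns_empty [simp]: "of_columns {#} j = 0"
  by (simp add: of_columns_def)

lemma of_columns_union [simp]: "of_columns (M + N) j = of_columns M j + of_columns N j"
  by (simp add: of_columns_def)

lemma set_mset_repeat [simp]: "set_mset (repeat_mset l M) = (if l = 0 then {} else set_mset M)"
  by (auto simp flip: count_greater_zero_iff)

lemma of_columns_repeat [simp]: "of_columns (repeat_mset l M) j = l * of_columns M j"
proof -
  have "filter_mset (\<lambda>x. j < x) (repeat_mset l M) = repeat_mset l (filter_mset (\<lambda>x. j < x) M)"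
    by (rule multiset_eqI) auto
  then show ?thesis by (simp add: of_columns_def)
qed

lemma of_columns_le_size: "of_columns M j \<le> size M"
  by (simp add: of_columns_def size_filter_mset_lesseq)

lemma of_columns_eq_size: "(\<And>x. x \<in># M \<Longrightarrow> j < x) \<Longrightarrow> of_columns M j = size M"
  unfolding of_columns_def by (subst filter_mset_eq_conv[THEN iffD2]) auto

lemma of_columns_less_size: "x \<in># M \<Longrightarrow> x \<le> j \<Longrightarrow> of_columns M j < size M"
  unfolding of_columns_def
  by (metis filter_mset_eq_conv leD multiset_filter_subset mset_subset_size subset_mset.less_le)

lemma of_columns_eq_0: "(\<And>x. x \<in># M \<Longrightarrow> x \<le> j) \<Longrightarrow> of_columns M j = 0"
  by (simp add: of_columns_def leD)

lemma antimono_of_columns: "antimono (of_columns M)"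
proof (rule antimonoI)
  fix i j :: nat
  assume "i \<le> j"
  then have "filter_mset (\<lambda>x. j < x) M \<subseteq># filter_mset (\<lambda>x. i < x) M"
    by (intro mset_subset_eqI) auto
  then show "of_columns M j \<le> of_columns M i"
    unfolding of_columns_def by (rule size_mset_mono)
qed

lemma is_partition_of_columns: "is_partition (of_columns M)"
proof -
  have "\<forall>i\<ge>Max (insert 0 (set_mset M)). of_columns M i = 0"
    by (auto intro!: of_columns_eq_0)
  with antimono_of_columns show ?thesis
    unfolding is_partition_def by blast
qed

text \<open>
  The heights are the parts of the conjugate partition, padded with zeros up to \<open>N\<close> of them.
\<close>

lemma partition_has_columns:
  assumes "lam \<in> Lambda_plus n" and "lam 0 \<le> N"
  obtains M where "lam = of_columns M" "size M = N" "\<And>x. x \<in># M \<Longrightarrow> x \<le> n"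
proof
  define h where "h c = card {i. i < n \<and> c < lam i}" for c
  define M where "M = image_mset h (mset_set {..<N})"
  have anti: "antimono lam" and zero: "\<And>i. i \<ge> n \<Longrightarrow> lam i = 0"
    using assms(1) by (auto simp: Lambda_plus_def is_partition_def)
  have h_iff: "j < h c \<longleftrightarrow> c < lam j" for j c
  proof
    assume "c < lam j"
    have "i < n \<and> c < lam i" if "i \<le> j" for i
    proof -
      have "c < lam i"
        using \<open>c < lam j\<close> antimonoD[OF anti that] by linarith
      then show ?thesis using zero[of i] by (cases "i < n") auto
    qed
    then have "{..j} \<subseteq> {i. i < n \<and> c < lam i}" by auto
    then have "card {..j} \<le> h c"
      unfolding h_def by (intro card_mono) auto
    then show "j < h c" by simp
  next
    assume *: "j < h c"
    show "c < lam j"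
    proof (rule ccontr)
      assume "\<not> c < lam j"
      then have "i < j" if "c < lam i" for i
        using that antimonoD[OF anti, of j i] by (cases "i < j") auto
      then have "{i. i < n \<and> c < lam i} \<subseteq> {..<j}" by auto
      then have "h c \<le> card {..<j}"
        unfolding h_def by (intro card_mono) auto
      with * show False by simp
    qed
  qed
  show "lam = of_columns M"
  proof
    fix j
    have "lam j \<le> N"
      using antimonoD[OF anti, of 0 j] assms(2) by simp
    then have "{c. c < N \<and> c < lam j} = {..<lam j}" by auto
    then show "lam j = of_columns M j"
      by (simp add: of_columns_def M_def filter_mset_image_mset h_iff)
  qed
  show "size M = N" by (simp add: M_def)
  show "x \<le> n" if "x \<in># M" for x
  proof -
    have "h c \<le> card {..<n}" for c
      unfolding h_def by (intro card_mono) auto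
    with that show ?thesis by (auto simp: M_def)
  qed
qed

section \<open>Distinguished partitions\<close>

text \<open>
  The leading entry of \<open>\<lambda>\<^sup>0\<close> is at most \<open>l - m\<close> also when \<open>k = 0\<close>, because the entries \<open>a\<close> are
  smaller still.
\<close>

lemma distinguished_first_part_le:
  assumes "distinguished l m mu"
  shows "mu 0 \<le> m * (l - 1)"
proof -
  from assms obtain k a lbar where m: "0 < m" "m < l" and a: "length a = m" "\<forall>x\<in>set a. x < l - m"
    and lbar: "lbar 0 < m"
    and mu: "mu = (\<lambda>j. nth_default 0 (replicate k (l - m) @ a) j + l * lbar j)"
    unfolding distinguished_def by blast
  have "nth_default 0 (replicate k (l - m) @ a) 0 \<le> l - m"
    using a by (cases k; cases a) (auto simp: nth_default_def)
  moreover have "l * lbar 0 \<le> l * (m - 1)"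
    using lbar by (intro mult_le_mono2) simp
  ultimately have "mu 0 \<le> (l - m) + l * (m - 1)"
    unfolding mu by linarith
  also have "\<dots> = m * (l - 1)"
  proof -
    have "l * (m - 1) = l * m - l" "m * (l - 1) = l * m - m" "l \<le> l * m"
      using m by (simp_all add: diff_mult_distrib2 mult.commute)
    with m show ?thesis by linarith
  qed
  finally show ?thesis .
qed

text \<open>
  The column heights of the part \<open>\<lambda>\<^sup>0\<close> of an \<open>m\<close>-distinguished partition, with \<open>m = l - size g\<close>.
  The index \<open>m\<close> is determined by the size, so it is not a parameter.
\<close>

definition narrow :: "nat \<Rightarrow> nat multiset \<Rightarrow> bool" where
  "narrow l g \<longleftrightarrow> g \<noteq> {#} \<and> size g < l \<and> (\<forall>x\<in>#g. \<forall>y\<in>#g. y \<le> x + (l - size g))"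

text \<open>
  The number \<open>k\<close> of leading entries \<open>l - m\<close> is the smallest height in \<open>g\<close>: rows of index less than \<open>k\<close> meet
  every column of \<open>g\<close>, row \<open>k\<close> misses the shortest one, and no column reaches row \<open>k + m\<close>. The heights
  in \<open>B\<close> are the columns of \<open>\<lambda>\<close>-bar, so there have to be fewer than \<open>m\<close> of them.
\<close>

lemma distinguished_of_columns:
  assumes g: "narrow l g" and B: "size B < l - size g"
  shows "distinguished l (l - size g) (of_columns (g + repeat_mset l B))"
proof -
  define m where "m = l - size g"
  define k where "k = Min (set_mset g)"
  define a where "a = map (\<lambda>i. of_columns g (k + i)) [0..<m]"
  have size: "0 < size g" "size g < l" and g0: "set_mset g \<noteq> {}"
    using g by (auto simp: narrow_def nonempty_has_size)
  then have m: "0 < m" "m < l" "l - m = size g" by (auto simp: m_def)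
  have "k \<in># g" using g0 by (simp add: k_def)
  have k_le: "k \<le> x" if "x \<in># g" for x
    using that by (simp add: k_def)
  with g have k_ge: "x \<le> k + m" if "x \<in># g" for x
    using that \<open>k \<in># g\<close> by (auto simp: narrow_def m_def)
  have "sorted_wrt (\<ge>) a"
    using antimonoD[OF antimono_of_columns]
    by (auto simp: a_def sorted_wrt_iff_nth_less)
  moreover have "\<forall>x\<in>set a. x < l - m"
    using \<open>k \<in># g\<close> by (auto simp: a_def m(3) intro: of_columns_less_size)
  moreover have row: "of_columns g j = nth_default 0 (replicate k (l - m) @ a) j" for j
  proof -
    consider "j < k" | "k \<le> j" "j < k + m" | "k + m \<le> j" by linarith
    then show ?thesis
    proof cases
      case 1
      then have "of_columns g j = size g"
        using k_le by (intro of_columns_eq_size) (meson order_less_le_trans)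
      with 1 m(3) show ?thesis by (simp add: nth_default_def nth_append)
    next
      case 2
      then have "a ! (j - k) = of_columns g j" by (simp add: a_def less_diff_conv2)
      with 2 show ?thesis by (simp add: nth_default_def nth_append a_def)
    next
      case 3
      then have "of_columns g j = 0"
        using k_ge by (intro of_columns_eq_0) (meson order_trans)
      with 3 show ?thesis by (simp add: nth_default_def a_def)
    qed
  qed
  moreover have "of_columns B 0 < m"
    using B of_columns_le_size[of B 0] by (simp add: m_def)
  moreover have "length a = m" by (simp add: a_def)
  moreover have "of_columns (g + repeat_mset l B) =
      (\<lambda>j. nth_default 0 (replicate k (l - m) @ a) j + l * of_columns B j)"
    by (rule ext) (simp add: row)
  ultimately show ?thesis
    unfolding distinguished_def m_def[symmetric]
    using m(1,2) is_partition_of_columns[of B]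
    by (intro conjI exI[of _ k] exI[of _ a] exI[of _ "of_columns B"])
qed

section \<open>Cutting a multiset of heights into narrow groups\<close>

text \<open>
  The bound \<open>c\<close> is the sum of the values \<open>l - size g\<close> over the groups cut off so far; it never
  exceeds a remaining height because a maximal group with \<open>m = l - size g\<close> starting at \<open>x\<close> is followed
  by a height of at least \<open>x + m\<close>. For \<open>m = 1\<close>, where the group is full, this uses that \<open>x\<close> occurs
  less than \<open>l\<close> times. The last group may stop for lack of heights rather than because the
  next one is too large; there the divisibility condition bounds \<open>l - size g\<close>.
\<close>

lemma greedy_narrow_groups:
  assumes "2 \<le> l" "sorted xs" "\<And>x. x \<in> set xs \<Longrightarrow> c \<le> x \<and> x \<le> n"
    and "\<And>x. count (mset xs) x < l" "c \<le> n" "l dvd length xs + (n - c)"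
  shows "\<exists>gs. sum_list gs = mset xs \<and> (\<forall>g\<in>set gs. narrow l g) \<and>
    c + (\<Sum>g\<leftarrow>gs. l - size g) \<le> n"
  using assms(2-)
proof (induction "length xs" arbitrary: xs c rule: less_induct)
  case less
  show ?case
  proof (cases "xs = []")
    case True
    with less.prems show ?thesis by (intro exI[of _ "[]"]) auto
  next
    case False
    define x where "x = xs ! 0"
    define fits where "fits w \<longleftrightarrow> 0 < w \<and> w < l \<and> w \<le> length xs \<and> xs ! (w - 1) \<le> x + (l - w)" for w
    \<comment> \<open>A single height is a narrow group, so a longest narrow initial segment exists.\<close>
    have fits1: "fits 1"
      using False \<open>2 \<le> l\<close> by (auto simp: fits_def x_def Suc_le_eq)
    define w where "w = (GREATEST w. fits w)"
    have "fits w"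
      unfolding w_def by (rule GreatestI_nat[of fits, OF fits1, of l]) (auto simp: fits_def)
    have w_max: "v \<le> w" if "fits v" for v
      unfolding w_def by (rule Greatest_le_nat[of fits, OF that, of l]) (auto simp: fits_def)
    have w: "0 < w" "w < l" "w \<le> length xs" "xs ! (w - 1) \<le> x + (l - w)"
      using \<open>fits w\<close> by (auto simp: fits_def)
    have x: "c \<le> x" using less.prems(2)[of x] False by (simp add: x_def)
    define g where "g = mset (take w xs)"
    have size_g: "size g = w" using w by (simp add: g_def)
    have "narrow l g"
    proof -
      have "x \<le> y \<and> y \<le> x + (l - w)" if "y \<in># g" for y
      proof -
        from that obtain i where i: "i < w" "y = xs ! i"
          using w by (auto simp: g_def in_set_conv_nth)
        with w less.prems(1) have "xs ! 0 \<le> y" "y \<le> xs ! (w - 1)"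
          by (auto intro!: sorted_nth_mono)
        with w show ?thesis by (simp add: x_def)
      qed
      then have "\<forall>y\<in>#g. \<forall>z\<in>#g. z \<le> y + (l - w)"
        by (meson add_le_mono1 order_trans)
      with w size_g show ?thesis by (auto simp: narrow_def)
    qed
    show ?thesis
    proof (cases "w = length xs")
      case True
      \<comment> \<open>A positive multiple of \<open>l\<close> is at least \<open>l\<close>.\<close>
      have "l \<le> length xs + (n - c)"
        using less.prems(5) False by (intro dvd_imp_le) auto
      then have "c + (l - w) \<le> n"
        using True less.prems(4) w by simp
      with \<open>narrow l g\<close> True show ?thesis
        by (intro exI[of _ "[g]"]) (auto simp: size_g g_def)
    next
      case False
      with w have w_less: "w < length xs" by simp
      have next_ge: "x + (l - w) \<le> xs ! w"
      proof (cases "w + 1 < l")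
        case True
        then have "\<not> fits (w + 1)" using w_max[of "w + 1"] by auto
        with True w_less show ?thesis by (auto simp: fits_def)
      next
        case False
        with w have l: "l = w + 1" by simp
        have "x \<noteq> xs ! w"
        proof
          assume eq: "x = xs ! w"
          have "xs ! i = x" if "i < l" for i
            using sorted_nth_mono[OF less.prems(1), of 0 i] sorted_nth_mono[OF less.prems(1), of i w]
              that w_less l eq by (auto simp: x_def)
          then have "take l xs = replicate l x"
            using w_less l by (intro nth_equalityI) (simp_all del: replicate_Suc)
          then have "l \<le> count (mset (take l xs)) x" by simp
          also have "\<dots> \<le> count (mset xs) x"
            by (metis append_take_drop_id mset_append mset_subset_eq_add_left mset_subset_eq_count)
          finally show False using less.prems(3)[of x] by simp
        qed
        moreover have "x \<le> xs ! w"
          using sorted_nth_mono[OF less.prems(1), of 0 w] w_less by (simp add: x_def)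
        ultimately show ?thesis using l by simp
      qed
      define ys where "ys = drop w xs"
      define d where "d = c + (l - w)"
      have xs: "xs = take w xs @ ys" by (simp add: ys_def)
      have ys_bounds: "d \<le> y \<and> y \<le> n" if "y \<in> set ys" for y
      proof -
        from that obtain i where i: "w + i < length xs" "y = xs ! (w + i)"
          using w_less by (auto simp: ys_def in_set_conv_nth less_diff_conv add.commute)
        then have "xs ! w \<le> y"
          using sorted_nth_mono[OF less.prems(1), of w "w + i"] by simp
        moreover have "y \<le> n" using less.prems(2)[of y] i by auto
        ultimately show ?thesis using next_ge x by (simp add: d_def)
      qed
      have "xs ! w \<in> set ys"
        using w_less by (simp add: ys_def flip: Cons_nth_drop_Suc)
      with ys_bounds have d_le: "d \<le> n" by (meson order_trans)
      have "length xs + (n - c) = l + (length ys + (n - d))"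
        using w w_less d_le less.prems(4) by (simp add: ys_def d_def)
      then have "l dvd length ys + (n - d)"
        using less.prems(5) by (metis dvd_add_right_iff dvd_refl)
      moreover have "count (mset ys) y < l" for y
        using less.prems(3)[of y] by (subst (asm) xs) simp
      moreover have "length ys < length xs" "sorted ys"
        using w w_less less.prems(1) by (auto simp: ys_def sorted_wrt_drop)
      ultimately obtain gs where gs: "sum_list gs = mset ys" "\<forall>g\<in>set gs. narrow l g"
          "d + (\<Sum>g\<leftarrow>gs. l - size g) \<le> n"
        using less.hyps[of ys d] ys_bounds d_le by auto
      have "g + mset ys = mset xs" by (subst xs) (simp add: g_def)
      with gs \<open>narrow l g\<close> show ?thesis
        by (intro exI[of _ "g # gs"]) (auto simp: size_g d_def)
    qed
  qed
qed

lemma mset_divide: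
  assumes "0 < l"
  shows "\<exists>R B. M = R + repeat_mset l B \<and> (\<forall>x. count R x < l)"
proof (induction "size M" arbitrary: M rule: less_induct)
  case less
  show ?case
  proof (cases "\<forall>x. count M x < l")
    case True
    then show ?thesis by (intro exI[of _ M] exI[of _ "{#}"]) auto
  next
    case False
    then obtain x where "l \<le> count M x" by (meson leI)
    then have M: "M = M - replicate_mset l x + replicate_mset l x"
      by (simp add: count_le_replicate_mset_subset_eq)
    then have "size M = size (M - replicate_mset l x) + l"
      by (metis size_replicate_mset size_union)
    with \<open>0 < l\<close> obtain R B where RB: "M - replicate_mset l x = R + repeat_mset l B" "\<forall>x. count R x < l"
      using less[of "M - replicate_mset l x"] by auto
    have "repeat_mset l (add_mset x B) = repeat_mset l B + replicate_mset l x"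
      by (rule multiset_eqI) auto
    with M RB show ?thesis
      by (intro exI[of _ R] exI[of _ "add_mset x B"]) (simp add: add.assoc)
  qed
qed

text \<open>
  The \<open>l\<close> copies of a height \<open>b\<close> form the two narrow groups \<open>{#b#}\<close> and \<open>l - 1\<close> copies of \<open>b\<close>.
  Turning one element of \<open>B\<close> into such a pair raises the sum of the values \<open>l - size g\<close> by exactly \<open>l\<close>.
\<close>

lemma blocks_as_narrow_groups:
  assumes "2 \<le> l" and "size B = u"
  shows "\<exists>gs. sum_list gs = repeat_mset l B \<and> (\<forall>g\<in>set gs. narrow l g) \<and>
    (\<Sum>g\<leftarrow>gs. l - size g) = u * l \<and> length gs = 2 * u"
  using assms(2)
proof (induction B arbitrary: u)
  case empty
  then show ?case by (intro exI[of _ "[]"]) auto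
next
  case (add b B)
  then obtain gs where gs: "sum_list gs = repeat_mset l B" "\<forall>g\<in>set gs. narrow l g"
    "(\<Sum>g\<leftarrow>gs. l - size g) = size B * l" "length gs = 2 * size B" by blast
  have "narrow l {#b#}" "narrow l (replicate_mset (l - 1) b)"
    using assms(1) by (auto simp: narrow_def nonempty_has_size split: if_splits)
  moreover have "{#b#} + (replicate_mset (l - 1) b + repeat_mset l B) = repeat_mset l (add_mset b B)"
    using assms(1) by (intro multiset_eqI) auto
  ultimately show ?case
    using gs add.prems assms(1)
    by (intro exI[of _ "{#b#} # replicate_mset (l - 1) b # gs"]) auto
qed

lemma sub_mset_of_size:
  assumes "k \<le> size B"
  obtains C where "C \<subseteq># B" "size C = k"
proof -
  obtain bs where bs: "mset bs = B" using ex_mset by blast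
  then have "mset (take k bs) \<subseteq># B"
    by (metis append_take_drop_id mset_append mset_subset_eq_add_left)
  with bs assms show ?thesis
    by (intro that[of "mset (take k bs)"]) auto
qed

text \<open>
  The condition on \<open>size B\<close> says that \<open>B\<close> has \<open>m - 1\<close> elements for each group of size \<open>l - m\<close>.
  Any way of dealing them out to the groups works, since \<open>\<lambda>\<close>-bar is arbitrary apart from its number of
  columns.
\<close>

lemma distribute_blocks:
  assumes "\<forall>g\<in>set gs. narrow l g" and "size B + length gs = (\<Sum>g\<leftarrow>gs. l - size g)"
    and "\<And>x. x \<in># sum_list gs + B \<Longrightarrow> x \<le> n"
  shows "\<exists>ps. (\<forall>(m, mu)\<in>set ps. mu \<in> Lambda_plus n \<and> distinguished l m mu) \<and>
    sum_list (map fst ps) = (\<Sum>g\<leftarrow>gs. l - size g) \<and>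
    (\<forall>j. (\<Sum>p\<leftarrow>ps. snd p j) = of_columns (sum_list gs + repeat_mset l B) j)"
  using assms
proof (induction gs arbitrary: B)
  case Nil
  then show ?case by (intro exI[of _ "[]"]) auto
next
  case (Cons g gs)
  define m where "m = l - size g"
  have "0 < m" using Cons.prems(1) by (simp add: narrow_def m_def)
  have "length gs \<le> (\<Sum>g\<leftarrow>gs. l - size g)"
    using Cons.prems(1) by (induction gs) (auto simp: narrow_def)
  then have "m - 1 \<le> size B"
    using Cons.prems(2) \<open>0 < m\<close> by (simp add: m_def)
  then obtain C where C: "C \<subseteq># B" "size C = m - 1"
    using sub_mset_of_size by blast
  then obtain D where D: "B = C + D" by (metis subset_mset.add_diff_inverse)
  have "size D + length gs = (\<Sum>g\<leftarrow>gs. l - size g)"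
    using Cons.prems(2) C D \<open>0 < m\<close> by (simp add: m_def)
  then obtain ps where ps: "\<forall>(m, mu)\<in>set ps. mu \<in> Lambda_plus n \<and> distinguished l m mu"
    "sum_list (map fst ps) = (\<Sum>g\<leftarrow>gs. l - size g)"
    "\<forall>j. (\<Sum>p\<leftarrow>ps. snd p j) = of_columns (sum_list gs + repeat_mset l D) j"
    using Cons.IH[of D] Cons.prems(1,3) D by auto
  define mu where "mu = of_columns (g + repeat_mset l C)"
  have dist: "distinguished l m mu"
    unfolding m_def mu_def using Cons.prems(1) C \<open>0 < m\<close>
    by (intro distinguished_of_columns) (auto simp: m_def)
  have le_n: "x \<le> n" if "x \<in># g + repeat_mset l C" for x
    using Cons.prems(3)[of x] that D by (auto split: if_splits)
  have "mu i = 0" if "i \<ge> n" for i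
    unfolding mu_def by (rule of_columns_eq_0) (use le_n that in \<open>fastforce dest: order_trans\<close>)
  then have Lambda: "mu \<in> Lambda_plus n"
    using is_partition_of_columns by (simp add: Lambda_plus_def mu_def)
  show ?case
  proof (intro exI[of _ "(m, mu) # ps"] conjI allI)
    show "\<forall>(m, mu)\<in>set ((m, mu) # ps). mu \<in> Lambda_plus n \<and> distinguished l m mu"
      using ps(1) dist Lambda by simp
    show "sum_list (map fst ((m, mu) # ps)) = (\<Sum>g\<leftarrow>g # gs. l - size g)"
      using ps(2) by (simp add: m_def)
    show "(\<Sum>p\<leftarrow>(m, mu) # ps. snd p j) = of_columns (sum_list (g # gs) + repeat_mset l B) j" for j
      using ps(3) by (simp add: mu_def D add_mult_distrib2)
  qed
qed

section \<open>The decomposition\<close>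

lemma decomposition_exists:
  assumes l: "2 \<le> l" and lam: "lam \<in> Lambda_plus n" "lam 0 \<le> n * (l - 1)"
  shows "\<exists>ps. (\<forall>(m, mu)\<in>set ps. mu \<in> Lambda_plus n \<and> distinguished l m mu) \<and>
    sum_list (map fst ps) = n \<and> (\<forall>j. (\<Sum>p\<leftarrow>ps. snd p j) = lam j)"
proof -
  obtain M where M: "lam = of_columns M" "size M = n * (l - 1)" "\<And>x. x \<in># M \<Longrightarrow> x \<le> n"
    using partition_has_columns[OF lam] by blast
  obtain R B where RB: "M = R + repeat_mset l B" "\<And>x. count R x < l"
    using mset_divide[of l M] l by auto
  have bound: "x \<le> n" if "x \<in># R + B" for x
    using M(3)[of x] that RB(1) l by auto
  have size_eq: "size R + n + l * size B = l * n"
    using M(2) RB(1) l by (cases l) (auto simp: algebra_simps)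
  then have "l dvd size R + n"
    by (metis dvd_add_left_iff dvd_triv_left)
  then obtain gs where gs: "sum_list gs = R" "\<forall>g\<in>set gs. narrow l g" "(\<Sum>g\<leftarrow>gs. l - size g) \<le> n"
    using greedy_narrow_groups[of l "sorted_list_of_multiset R" 0 n] l bound RB(2)
    by (auto simp flip: size_mset)
  define P where "P = (\<Sum>g\<leftarrow>gs. l - size g)"
  have "P + size (sum_list gs) = l * length gs" "length gs \<le> P"
    unfolding P_def using gs(2) by (induction gs) (auto simp: narrow_def)
  then have P: "P + size R = l * length gs" "length gs \<le> P" using gs(1) by auto
  \<comment> \<open>Both \<open>size R\<close> and the size of \<open>M\<close> are known modulo \<open>l\<close>, which makes \<open>n - P\<close> a multiple of \<open>l\<close>.\<close>
  have eq: "l * n = (n - P) + l * (size B + length gs)"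
    using size_eq P(1) gs(3) unfolding P_def add_mult_distrib2 by arith
  then have "l dvd n - P"
    by (metis dvd_add_left_iff dvd_triv_left)
  then obtain u where u: "n - P = l * u" by blast
  with eq have "l * n = l * (u + size B + length gs)" by (simp add: algebra_simps)
  with l have n: "n = u + size B + length gs" by simp
  \<comment> \<open>\<open>B\<close> has enough elements: \<open>length gs + 2 * u \<le> P + l * u = n = u + size B + length gs\<close>.\<close>
  have "2 * u \<le> l * u" using l by simp
  then have "u \<le> size B" using n u P(2) gs(3) unfolding P_def by linarith
  then obtain C where C: "C \<subseteq># B" "size C = u"
    using sub_mset_of_size by blast
  then obtain D where D: "B = C + D" by (metis subset_mset.add_diff_inverse)
  obtain hs where hs: "sum_list hs = repeat_mset l C" "\<forall>g\<in>set hs. narrow l g"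
    "(\<Sum>g\<leftarrow>hs. l - size g) = u * l" "length hs = 2 * u"
    using blocks_as_narrow_groups[OF l C(2)] by blast
  have total: "(\<Sum>g\<leftarrow>gs @ hs. l - size g) = n"
    using u hs(3) gs(3) by (simp add: P_def mult.commute)
  have narrow: "\<forall>g\<in>set (gs @ hs). narrow l g"
    using gs(2) hs(2) by auto
  have size_D: "size D + length (gs @ hs) = n"
    using n D C hs(4) by simp
  have le_n: "x \<le> n" if "x \<in># sum_list (gs @ hs) + D" for x
    using that bound[of x] gs(1) hs(1) D by (auto split: if_splits)
  obtain ps where ps: "\<forall>(m, mu)\<in>set ps. mu \<in> Lambda_plus n \<and> distinguished l m mu"
    "sum_list (map fst ps) = n"
    "\<forall>j. (\<Sum>p\<leftarrow>ps. snd p j) = of_columns (sum_list (gs @ hs) + repeat_mset l D) j"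
    using distribute_blocks[OF narrow, of D n, unfolded total, OF size_D le_n] by blast
  have "sum_list (gs @ hs) + repeat_mset l D = M"
    unfolding RB(1) D by (simp add: gs(1) hs(1) add.assoc)
  with ps have "\<forall>j. (\<Sum>p\<leftarrow>ps. snd p j) = lam j"
    unfolding M(1) by metis
  with ps(1,2) show ?thesis by blast
qed

text \<open>
  For \<open>q \<noteq> 1\<close> the geometric sum over a full period of \<open>q\<close> vanishes; for \<open>q = 1\<close> the sum up to the
  characteristic does. The value \<open>l = 1\<close> is impossible because the sum is then \<open>1\<close>.
\<close>

lemma quantum_char_ge_2:
  fixes q :: "'k::field"
  assumes "\<exists>r>0. q ^ r = 1" and "CHAR('k) = 0 \<Longrightarrow> q \<noteq> 1"
  shows "2 \<le> quantum_char q"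
proof -
  have "\<exists>l>0. (\<Sum>i<l. q ^ i) = 0"
  proof (cases "q = 1")
    case True
    with assms(2) have "0 < CHAR('k)" by auto
    with True show ?thesis by (intro exI[of _ "CHAR('k)"]) auto
  next
    case False
    with assms(1) show ?thesis by (auto simp: geometric_sum)
  qed
  then have "0 < quantum_char q \<and> (\<Sum>i<quantum_char q. q ^ i) = 0"
    unfolding quantum_char_def by (rule LeastI_ex)
  then show ?thesis
    by (cases "quantum_char q = 1") auto
qed

theorem corollary6p7:
  fixes q :: "'k::field" and l n :: nat and lam :: "nat \<Rightarrow> nat"
  assumes "q \<noteq> 0"
    and "\<exists>r>0. q ^ r = 1"
    and "CHAR('k) = 0 \<Longrightarrow> q \<noteq> 1"
    and "l = quantum_char q"
    and "n \<ge> 1"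
    and "lam \<in> Lambda_plus n"
  shows "lam 0 \<le> n * (l - 1) \<longleftrightarrow>
    (\<exists>(s::nat) (ns :: nat \<Rightarrow> nat) (mu :: nat \<Rightarrow> nat \<Rightarrow> nat).
       (\<forall>i\<in>{1..s}. ns i > 0) \<and>
       n = (\<Sum>i=1..s. ns i) \<and>
       (\<forall>i\<in>{1..s}. mu i \<in> Lambda_plus n \<and> distinguished l (ns i) (mu i)) \<and>
       lam = (\<lambda>j. \<Sum>i=1..s. mu i j))"
    (is "_ \<longleftrightarrow> ?decomposable")
proof
  assume "lam 0 \<le> n * (l - 1)"
  moreover have "2 \<le> l"
    using quantum_char_ge_2[of q] assms(2,3,4) by simp
  ultimately obtain ps where ps: "\<forall>(m, mu)\<in>set ps. mu \<in> Lambda_plus n \<and> distinguished l m mu"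
    "sum_list (map fst ps) = n" "\<forall>j. (\<Sum>p\<leftarrow>ps. snd p j) = lam j"
    using decomposition_exists assms(6) by blast
  have sum_nth: "(\<Sum>p\<leftarrow>ps. f p) = (\<Sum>i=1..length ps. f (ps ! (i - 1)))" for f :: "_ \<Rightarrow> nat"
    by (simp add: sum_list_sum_nth atLeast0LessThan sum.atLeast1_atMost_eq)
  have dist: "snd (ps ! (i - 1)) \<in> Lambda_plus n \<and>
      distinguished l (fst (ps ! (i - 1))) (snd (ps ! (i - 1)))"
    if "i \<in> {1..length ps}" for i
  proof -
    have "ps ! (i - 1) \<in> set ps" using that by auto
    with ps(1) show ?thesis by (auto simp: case_prod_beta)
  qed
  have "n = (\<Sum>i=1..length ps. fst (ps ! (i - 1)))"
    using ps(2) sum_nth[of fst] by simp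
  moreover have "lam = (\<lambda>j. \<Sum>i=1..length ps. snd (ps ! (i - 1)) j)"
  proof
    fix j
    show "lam j = (\<Sum>i=1..length ps. snd (ps ! (i - 1)) j)"
      using ps(3) sum_nth[of "\<lambda>p. snd p j"] by simp
  qed
  moreover have "\<forall>i\<in>{1..length ps}. fst (ps ! (i - 1)) > 0"
    using dist unfolding distinguished_def by blast
  ultimately show ?decomposable
    using dist
    by (intro exI[of _ "length ps"] exI[of _ "\<lambda>i. fst (ps ! (i - 1))"]
        exI[of _ "\<lambda>i. snd (ps ! (i - 1))"]) simp
next
  assume ?decomposable
  then show "lam 0 \<le> n * (l - 1)"
  proof (elim exE conjE)
    fix s ns and mu :: "nat \<Rightarrow> nat \<Rightarrow> nat"
    assume n: "n = (\<Sum>i=1..s. ns i)" and lam: "lam = (\<lambda>j. \<Sum>i=1..s. mu i j)"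
      and dist: "\<forall>i\<in>{1..s}. mu i \<in> Lambda_plus n \<and> distinguished l (ns i) (mu i)"
    have "lam 0 \<le> (\<Sum>i=1..s. ns i * (l - 1))"
      unfolding lam using dist by (intro sum_mono distinguished_first_part_le) auto
    then show "lam 0 \<le> n * (l - 1)"
      by (simp add: n sum_distrib_right)
  qed
qed

end
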